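(* Let $n\ge1$, let $\rho$ be a positive smooth function on $\mathbb R^n$, $d\mu(x)=\rho(x)\,dx$, $V=\rho^{-1/2}$, $Lf=\Delta f+\nabla\log\rho\cdot\nabla f$ and $\mathcal E(f,f)=\int_{\mathbb R^n}|\nabla f|^2\,d\mu$. Let $C_n>0$ be a constant. Then the classical Nash inequality $$\left(\int_{\mathbb R^n} f^2dx\right)^{\frac12\left(1+\frac n2\right)}\le C_n\left(\int_{\mathbb R^n}|f|\,dx\right)\left(\int_{\mathbb R^n}|\nabla f|^2dx\right)^{\frac n4}\quad\text{for all smooth compactly supported } f \text{ on }\mathbb R^n$$ is equivalent to $$\|f\|_2^{2+\frac4n}\le C_n^{\frac4n}\,\|fV\|_1^{\frac4n}\left(\mathcal E(f,f)+\int_{\mathbb R^n}\frac{LV}{V}f^2\,d\mu\right)\quad\text{for all smooth compactly supported } f\text{ on }\mathbb R^n .$$ If moreover $LV\le cV$ for some $c\in\mathbb R$, then, with $C_n$ a constant for which the classical Nash inequality holds, $$\|f\|_2^{2+\frac4n}\le C_n^{\frac4n}\,\|fV\|_1^{\frac4n}\left(\mathcal E(f,f)+c\int_{\mathbb R^n}f^2\,d\mu\right)$$ for all smooth compactly supported functions $f$ on $\mathbb R^n$.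
   Context: Functions are real-valued. $\|\cdot\|_p$ denotes the norm of $\mathcal L^p(\mu)$ with $d\mu=\rho\,dx$ (not with respect to Lebesgue measure); $\mu$ may have finite or infinite mass. *)

theory Defs
  imports "HOL-Analysis.Analysis"
begin

definition partial :: "'n::finite \<Rightarrow> (real^'n \<Rightarrow> real) \<Rightarrow> real^'n \<Rightarrow> real" where
  "partial i f x = frechet_derivative f (at x) (axis i 1)"

primrec C_k :: "nat \<Rightarrow> (real^'n::finite \<Rightarrow> real) \<Rightarrow> bool" where
  "C_k 0 f \<longleftrightarrow> continuous_on UNIV f"
| "C_k (Suc k) f \<longleftrightarrow> (\<forall>x. f differentiable (at x)) \<and> (\<forall>i. C_k k (partial i f))"

definition smooth :: "(real^'n::finite \<Rightarrow> real) \<Rightarrow> bool" where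
  "smooth f \<longleftrightarrow> (\<forall>k. C_k k f)"

definition test_function :: "(real^'n::finite \<Rightarrow> real) \<Rightarrow> bool" where
  "test_function f \<longleftrightarrow> smooth f \<and> compact (closure {x. f x \<noteq> 0})"

definition grad :: "(real^'n::finite \<Rightarrow> real) \<Rightarrow> real^'n \<Rightarrow> real^'n" where
  "grad f x = (\<chi> i. partial i f x)"

definition laplacian :: "(real^'n::finite \<Rightarrow> real) \<Rightarrow> real^'n \<Rightarrow> real" where
  "laplacian f x = (\<Sum>i\<in>UNIV. partial i (partial i f) x)"

definition weighted_measure :: "(real^'n::finite \<Rightarrow> real) \<Rightarrow> (real^'n) measure" where
  "weighted_measure \<rho> = density lborel (\<lambda>x. ennreal (\<rho> x))"

definition generator ::
    "(real^'n::finite \<Rightarrow> real) \<Rightarrow> (real^'n \<Rightarrow> real) \<Rightarrow> real^'n \<Rightarrow> real" where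
  "generator \<rho> f x = laplacian f x + grad (\<lambda>y. ln (\<rho> y)) x \<bullet> grad f x"

definition dirichlet_energy :: "(real^'n::finite \<Rightarrow> real) \<Rightarrow> (real^'n \<Rightarrow> real) \<Rightarrow> real" where
  "dirichlet_energy \<rho> f = (LINT x|weighted_measure \<rho>. (norm (grad f x))\<^sup>2)"

text \<open>The Bochner integral is 0 on non-integrable functions, so the value below is the
  \<open>L\<^sup>p\<close>-norm only for functions that lie in \<open>L\<^sup>p\<close>. Continuous compactly supported functions
  do, for any measure with a continuous density.\<close>

definition lp_norm :: "'a measure \<Rightarrow> real \<Rightarrow> ('a \<Rightarrow> real) \<Rightarrow> real" where
  "lp_norm M p f = (LINT x|M. \<bar>f x\<bar> powr p) powr (1 / p)"

end

(* The ground-state substitution g = f sqrt(rho) maps test functions onto test functions, turns the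
   integrals of f^2 and |f| V against mu into Lebesgue integrals of g^2 and |g|, and satisfies
     |grad g|^2 = rho |grad f|^2 + rho (L V / V) f^2 + div (f^2 (grad rho) / 2).
   The divergence integrates to zero, so the two inequalities for g and f differ only by raising
   both sides to the power 4/n. *)

theory Submission
  imports Defs
begin

section \<open>Partial derivatives and smoothness\<close>

lemma partial_eqI: "(f has_derivative f') (at x) \<Longrightarrow> partial i f x = f' (axis i 1)"
  unfolding partial_def by (metis frechet_derivative_at)

lemma has_derivative_frechet:
  "f differentiable (at x) \<Longrightarrow> (f has_derivative frechet_derivative f (at x)) (at x)"
  by (simp add: frechet_derivative_works)

lemma partial_const: "partial i (\<lambda>x. c) x = 0"
  by (rule partial_eqI[of _ "\<lambda>_. 0", simplified]) simp

lemma partial_add: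
  assumes "f differentiable (at x)" "g differentiable (at x)"
  shows "partial i (\<lambda>x. f x + g x) x = partial i f x + partial i g x"
  using partial_eqI[OF has_derivative_add[OF assms[THEN has_derivative_frechet]]]
  by (simp add: partial_def)

lemma partial_mult:
  assumes "f differentiable (at x)" "g differentiable (at x)"
  shows "partial i (\<lambda>x. f x * g x) x = f x * partial i g x + partial i f x * g x"
  using partial_eqI[OF has_derivative_mult[OF assms[THEN has_derivative_frechet]]]
  by (simp add: partial_def)

lemma has_derivative_compose_real:
  assumes "f differentiable (at x)" "(\<phi> has_field_derivative d) (at (f x))"
  shows "((\<lambda>x. \<phi> (f x)) has_derivative (\<lambda>h. d * frechet_derivative f (at x) h)) (at x)"
  using has_derivative_compose[OF has_derivative_frechet[OF assms(1)],
      of \<phi> "(*) d"] assms(2) by (simp add: has_field_derivative_def)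

lemma partial_compose_real:
  assumes "f differentiable (at x)" "(\<phi> has_field_derivative d) (at (f x))"
  shows "partial i (\<lambda>x. \<phi> (f x)) x = d * partial i f x"
  using partial_eqI[OF has_derivative_compose_real[OF assms]] by (simp add: partial_def)

lemma differentiable_powr_real:
  assumes "f differentiable (at x)" "f x > 0"
  shows "(\<lambda>x. f x powr a :: real) differentiable (at x)"
  using has_derivative_compose_real[OF assms(1) has_real_derivative_powr[OF assms(2)]]
  unfolding differentiable_def by blast

lemma partial_powr:
  assumes "f differentiable (at x)" "f x > 0"
  shows "partial i (\<lambda>x. f x powr a) x = a * f x powr (a - 1) * partial i f x"
  using partial_compose_real[OF assms(1) has_real_derivative_powr[OF assms(2)]] by simp

lemma partial_ln:
  assumes "f differentiable (at x)" "f x > 0"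
  shows "partial i (\<lambda>x. ln (f x)) x = partial i f x / f x"
  using partial_compose_real[OF assms(1) DERIV_ln[OF assms(2)]] by (simp add: field_simps)

section \<open>Closure properties of the classes \<open>C_k\<close> and of smooth functions\<close>

lemma C_k_continuous_on: "C_k k f \<Longrightarrow> continuous_on UNIV f"
  by (cases k) (auto intro!: continuous_at_imp_continuous_on differentiable_imp_continuous_within)

text \<open>The recursion for \<open>C_k (Suc k)\<close> constrains only the partial derivatives, so
  the inclusion needs an induction; its base is that differentiability implies continuity.\<close>

lemma C_k_Suc_imp: "C_k (Suc k) f \<Longrightarrow> C_k k f"
proof (induction k arbitrary: f)
  case 0
  then show ?case using C_k_continuous_on C_k.simps(1) by blast
next
  case (Suc k)
  then show ?case by (metis C_k.simps(2))
qed

lemma C_k_const: "C_k k (\<lambda>x. c)"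
  by (induction k arbitrary: c) (auto simp: partial_const[abs_def])

lemma C_k_add: "C_k k f \<Longrightarrow> C_k k g \<Longrightarrow> C_k k (\<lambda>x. f x + g x)"
proof (induction k arbitrary: f g)
  case 0
  then show ?case by (simp add: continuous_on_add)
next
  case (Suc k)
  have "partial i (\<lambda>x. f x + g x) = (\<lambda>x. partial i f x + partial i g x)" for i
    using Suc.prems by (auto simp: partial_add)
  then show ?case using Suc.prems Suc.IH by (simp add: differentiable_add)
qed

lemma C_k_mult: "C_k k f \<Longrightarrow> C_k k g \<Longrightarrow> C_k k (\<lambda>x. f x * g x)"
proof (induction k arbitrary: f g)
  case 0
  then show ?case by (simp add: continuous_on_mult)
next
  case (Suc k)
  have "partial i (\<lambda>x. f x * g x) = (\<lambda>x. f x * partial i g x + partial i f x * g x)" for i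
    using Suc.prems by (auto simp: partial_mult)
  \<comment> \<open>The product rule leaves one factor undifferentiated in each term, so
    \<open>f\<close> and \<open>g\<close> themselves must be in the lower class.\<close>
  moreover have "C_k k f" "C_k k g" using Suc.prems by (auto intro: C_k_Suc_imp)
  ultimately show ?case using Suc.prems Suc.IH by (simp add: differentiable_mult C_k_add)
qed

text \<open>Differentiation lowers the exponent by one, hence the induction has to run over all
  exponents at once. Positivity keeps every real power differentiable.\<close>

lemma C_k_powr:
  assumes "\<And>x. f x > 0"
  shows "C_k k f \<Longrightarrow> C_k k (\<lambda>x. f x powr a)"
proof (induction k arbitrary: a)
  case 0
  then show ?case using assms by (auto intro!: continuous_intros simp: less_imp_neq[symmetric])
next
  case (Suc k)
  have "partial i (\<lambda>x. f x powr a) = (\<lambda>x. a * f x powr (a - 1) * partial i f x)" for i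
    using Suc.prems assms by (auto simp: partial_powr)
  moreover have "C_k k (\<lambda>x. a * f x powr (a - 1) * partial i f x)" for i
    using Suc.prems C_k_Suc_imp[OF Suc.prems] by (intro C_k_mult C_k_const Suc.IH) simp_all
  ultimately show ?case using Suc.prems assms by (auto intro: differentiable_powr_real)
qed

lemma smooth_mult: "smooth f \<Longrightarrow> smooth g \<Longrightarrow> smooth (\<lambda>x. f x * g x)"
  by (simp add: smooth_def C_k_mult)

lemma smooth_powr: "smooth f \<Longrightarrow> (\<And>x. f x > 0) \<Longrightarrow> smooth (\<lambda>x. f x powr a)"
  by (simp add: smooth_def C_k_powr)

lemma smooth_const: "smooth (\<lambda>x. c)"
  by (simp add: smooth_def C_k_const)

lemma smooth_partial: "smooth f \<Longrightarrow> smooth (partial i f)"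
  unfolding smooth_def by (metis C_k.simps(2))

lemma smooth_differentiable: "smooth f \<Longrightarrow> f differentiable (at x)"
  unfolding smooth_def by (metis C_k.simps(2))

lemma smooth_continuous_on: "smooth f \<Longrightarrow> continuous_on UNIV f"
  unfolding smooth_def using C_k_continuous_on by blast

lemma smooth_measurable: "smooth f \<Longrightarrow> f \<in> borel_measurable borel"
  by (intro borel_measurable_continuous_onI smooth_continuous_on)

section \<open>Supports of test functions and of their derivatives\<close>

lemma test_function_mult:
  assumes "test_function f" "smooth g"
  shows "test_function (\<lambda>x. f x * g x)"
proof -
  let ?K = "closure {x. f x \<noteq> 0}" and ?L = "closure {x. f x * g x \<noteq> 0}"
  \<comment> \<open>The support of the product is a closed subset of a compact set; writing it as an
    intersection with \<open>?K\<close> exhibits its compactness.\<close>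
  have "?L \<subseteq> ?K" by (rule closure_mono) auto
  then have "?K \<inter> ?L = ?L" by (rule inf.absorb2)
  moreover have "compact (?K \<inter> ?L)"
    using assms(1) by (intro compact_Int_closed closed_closure) (simp add: test_function_def)
  ultimately have "compact ?L" by (simp only:)
  then show ?thesis using assms by (simp add: test_function_def smooth_mult)
qed

lemma zero_outside_closure: "x \<notin> closure {x. f x \<noteq> 0} \<Longrightarrow> f x = 0"
  using closure_subset[of "{x. f x \<noteq> 0}"] by blast

text \<open>The complement of the support is open, so near such a point the function coincides with
  zero and inherits its derivative.\<close>

lemma partial_zero_outside_closure:
  assumes "x \<notin> closure {x. f x \<noteq> 0}"
  shows "partial i f x = 0"
proof -
  have "(f has_derivative (\<lambda>_. 0)) (at x)"
    by (rule has_derivative_transform_within_open[of "\<lambda>_. 0" _ x UNIV "- closure {x. f x \<noteq> 0}"])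
      (use assms in \<open>auto dest: zero_outside_closure\<close>)
  from partial_eqI[OF this] show ?thesis .
qed

lemma grad_zero_outside_closure: "x \<notin> closure {x. f x \<noteq> 0} \<Longrightarrow> grad f x = 0"
  by (simp add: grad_def partial_zero_outside_closure vec_eq_iff)

lemma norm_grad_power2: "(norm (grad f x))\<^sup>2 = (\<Sum>i\<in>UNIV. (partial i f x)\<^sup>2)"
  unfolding power2_norm_eq_inner grad_def by (simp add: inner_vec_def power2_eq_square)

lemma continuous_norm_grad_power2:
  "smooth f \<Longrightarrow> continuous_on UNIV (\<lambda>x. (norm (grad f x))\<^sup>2)"
  unfolding norm_grad_power2 by (intro continuous_intros smooth_continuous_on smooth_partial)

section \<open>Integration by parts\<close>

lemma integrable_compact_support:
  fixes f :: "'a::euclidean_space \<Rightarrow> real"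
  assumes "continuous_on UNIV f" "compact K" "\<And>x. x \<notin> K \<Longrightarrow> f x = 0"
  shows "integrable lborel f"
proof -
  have "integrable lborel (\<lambda>x. indicator K x *\<^sub>R f x)"
    by (intro borel_integrable_compact assms continuous_on_subset[OF assms(1)]) auto
  moreover have "(\<lambda>x. indicator K x *\<^sub>R f x) = f"
    by (rule ext) (use assms(3) in \<open>auto simp: indicator_def\<close>)
  ultimately show ?thesis by simp
qed

lemma bounded_compact_support:
  fixes f :: "'a::euclidean_space \<Rightarrow> real"
  assumes "continuous_on UNIV f" "compact K" "\<And>x. x \<notin> K \<Longrightarrow> f x = 0"
  obtains B where "B \<ge> 0" "\<And>x. \<bar>f x\<bar> \<le> B"
proof -
  have "bounded (f ` K)"
    by (intro compact_imp_bounded compact_continuous_image assms(2)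
        continuous_on_subset[OF assms(1)]) simp
  then obtain B where "\<And>x. x \<in> K \<Longrightarrow> \<bar>f x\<bar> \<le> B"
    unfolding bounded_iff by auto
  \<comment> \<open>If \<open>K\<close> is empty then \<open>B\<close> is arbitrary and may be
    negative; the maximum also covers the points outside \<open>K\<close>, where \<open>f\<close>
    vanishes.\<close>
  then have "\<bar>f x\<bar> \<le> max B 0" for x using assms(3)[of x] by (cases "x \<in> K") fastforce+
  then show ?thesis using that[of "max B 0"] by auto
qed

section \<open>Translations and difference quotients\<close>

lemma integral_translate:
  fixes f :: "'a::euclidean_space \<Rightarrow> real"
  assumes "f \<in> borel_measurable borel"
  shows "(LINT x|lborel. f (x + a)) = (LINT x|lborel. f x)"
proof -
  have "(LINT x|lborel. f x) = (LINT x|distr lborel borel ((+) a). f x)"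
    by (simp add: lborel_distr_plus)
  also have "\<dots> = (LINT x|lborel. f (a + x))"
    using assms by (intro integral_distr) auto
  finally show ?thesis by (simp add: add.commute)
qed

lemma integrable_translate:
  fixes f :: "'a::euclidean_space \<Rightarrow> real"
  assumes "integrable lborel f"
  shows "integrable lborel (\<lambda>x. f (x + a))"
proof -
  have "integrable (distr lborel borel ((+) a)) f"
    using assms by (simp add: lborel_distr_plus)
  then show ?thesis
    by (subst (asm) integrable_distr_eq) (use assms in \<open>auto simp: add.commute\<close>)
qed

text \<open>Restriction to a coordinate line reduces partial derivatives to one-variable calculus,
  both for the mean value theorem and for the limit of difference quotients.\<close>

lemma DERIV_line:
  fixes f :: "real^'n::finite \<Rightarrow> real"
  assumes "\<And>x. f differentiable (at x)"
  shows "((\<lambda>s. f (x + s *\<^sub>R axis i 1)) has_field_derivative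
           partial i f (x + s *\<^sub>R axis i 1)) (at s)"
proof -
  let ?D = "frechet_derivative f (at (x + s *\<^sub>R axis i 1))"
  have D: "(f has_derivative ?D) (at (x + s *\<^sub>R axis i 1))"
    by (rule has_derivative_frechet[OF assms])
  have "((\<lambda>s. f (x + s *\<^sub>R axis i 1)) has_derivative (\<lambda>t. ?D (t *\<^sub>R axis i 1))) (at s)"
    by (rule has_derivative_compose[where f="\<lambda>s. x + s *\<^sub>R axis i 1" and g=f, OF _ D]) (auto intro!: derivative_eq_intros)
  moreover have "(\<lambda>t. ?D (t *\<^sub>R axis i 1)) = (*) (partial i f (x + s *\<^sub>R axis i 1))"
    using has_derivative_bounded_linear[OF D]
    by (auto simp: partial_def linear_cmul bounded_linear.linear mult.commute)
  ultimately show ?thesis by (simp add: has_field_derivative_def)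
qed

text \<open>By the mean value theorem the quotient is a value of the partial derivative on the
  segment. The bound is uniform in \<open>x\<close> and \<open>s\<close>, as domination
  requires.\<close>

lemma difference_quotient_bound:
  fixes f :: "real^'n::finite \<Rightarrow> real"
  assumes "\<And>x. f differentiable (at x)" "\<And>x. \<bar>partial i f x\<bar> \<le> B" "s > 0"
  shows "\<bar>(f (x + s *\<^sub>R axis i 1) - f x) / s\<bar> \<le> B"
proof -
  obtain z where "f (x + s *\<^sub>R axis i 1) - f (x + 0 *\<^sub>R axis i 1)
      = (s - 0) * partial i f (x + z *\<^sub>R axis i 1)"
    using MVT2[OF assms(3) DERIV_line[OF assms(1)], of x i] by blast
  then show ?thesis using assms(2,3) by simp
qed

text \<open>Translation invariance makes the integral of every difference quotient vanish, and dominated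
  convergence passes to the limit; this avoids Fubini.\<close>

lemma integral_partial_eq_0:
  fixes f :: "real^'n::finite \<Rightarrow> real"
  assumes "C_k 1 f" "compact (closure {x. f x \<noteq> 0})"
  shows "(LINT x|lborel. partial i f x) = 0"
proof -
  let ?K = "closure {x. f x \<noteq> 0}" and ?e = "axis i 1 :: real^'n"
  \<comment> \<open>Dominated convergence is applied along a sequence; these steps are positive,
    tend to 0 and never exceed 1.\<close>
  define s :: "nat \<Rightarrow> real" where "s k = inverse (real (Suc k))" for k
  define q where "q k x = (f (x + s k *\<^sub>R ?e) - f x) / s k" for k x
  have diff: "\<And>x. f differentiable (at x)" and cont': "continuous_on UNIV (partial i f)"
    using assms(1) by auto
  have cont: "continuous_on UNIV f" by (rule C_k_continuous_on[OF assms(1)])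
  have s: "0 < s k" "s k \<le> 1" for k by (auto simp: s_def field_simps)
  have s0: "s \<longlonglongrightarrow> 0" unfolding s_def[abs_def] by (rule LIMSEQ_inverse_real_of_nat)
  obtain B where B: "B \<ge> 0" "\<And>x. \<bar>partial i f x\<bar> \<le> B"
    using bounded_compact_support[OF cont' assms(2) partial_zero_outside_closure] by blast
  obtain R where R: "\<And>x. x \<in> ?K \<Longrightarrow> norm x \<le> R"
    using compact_imp_bounded[OF assms(2)] unfolding bounded_iff by blast
  have int: "integrable lborel f"
    by (rule integrable_compact_support[OF cont assms(2)]) (rule zero_outside_closure)
  have q0: "(LINT x|lborel. q k x) = 0" for k
    using int integrable_translate[OF int, of "s k *\<^sub>R ?e"]
    by (simp add: q_def integral_translate)
  have lim: "(\<lambda>k. q k x) \<longlonglongrightarrow> partial i f x" for x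
  proof -
    have "((\<lambda>h. (f (x + h *\<^sub>R ?e) - f x) / h) \<longlongrightarrow> partial i f x) (at 0)"
      using DERIV_line[OF diff, of x i 0] by (simp add: DERIV_def)
    then show ?thesis
      unfolding q_def
      by (rule filterlim_compose) (use s0 s(1) in \<open>auto simp: filterlim_at less_imp_neq[symmetric]\<close>)
  qed
  \<comment> \<open>Shifts have length at most 1, so beyond radius \<open>R + 1\<close> both
    \<open>x\<close> and its translate lie outside the support and the quotient is 0. One ball thus
    serves for all \<open>k\<close>.\<close>
  have bound: "norm (q k x) \<le> B * indicator (cball 0 (R + 1)) x" for k x
  proof (cases "norm x \<le> R + 1")
    case True
    then show ?thesis
      using difference_quotient_bound[OF diff B(2) s(1), of x k] by (simp add: q_def)
  next
    case False
    have "norm x \<le> norm (x + s k *\<^sub>R ?e) + norm (s k *\<^sub>R ?e)"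
      by (metis add_diff_cancel_right' norm_triangle_ineq4)
    then have "\<not> norm (x + s k *\<^sub>R ?e) \<le> R" using False s[of k] by simp
    moreover have "\<not> norm x \<le> R" using False by simp
    ultimately have "f (x + s k *\<^sub>R ?e) = 0" "f x = 0"
      using R zero_outside_closure by blast+
    then show ?thesis using B(1) by (simp add: q_def)
  qed
  have "(\<lambda>k. LINT x|lborel. q k x) \<longlonglongrightarrow> (LINT x|lborel. partial i f x)"
  proof (rule integral_dominated_convergence[where w="\<lambda>x. B * indicator (cball 0 (R + 1)) x"])
    show "integrable lborel (\<lambda>x. B * indicator (cball (0::real^'n) (R + 1)) x)"
      using emeasure_lborel_cball_finite by (intro integrable_mult_right integrable_real_indicator) auto
    have [measurable]: "f \<in> borel_measurable borel"
      using cont by (rule borel_measurable_continuous_onI)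
    show "q k \<in> borel_measurable lborel" for k unfolding q_def by measurable
    show "partial i f \<in> borel_measurable lborel"
      using borel_measurable_continuous_onI[OF cont'] by simp
  qed (use lim bound in auto)
  then show ?thesis unfolding q0 using LIMSEQ_unique tendsto_const by blast
qed

section \<open>The weighted energy identity\<close>

lemma integral_weighted_measure:
  fixes \<rho> :: "real^'n::finite \<Rightarrow> real"
  assumes "smooth \<rho>" "\<And>x. \<rho> x > 0" "f \<in> borel_measurable borel"
  shows "(LINT x|weighted_measure \<rho>. f x) = (LINT x|lborel. \<rho> x * f x)"
  unfolding weighted_measure_def
  using assms by (subst integral_density) (auto simp: smooth_measurable less_imp_le)

lemma integrable_weighted_measure:
  fixes \<rho> :: "real^'n::finite \<Rightarrow> real"
  assumes "smooth \<rho>" "\<And>x. \<rho> x > 0" "f \<in> borel_measurable borel"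
  shows "integrable (weighted_measure \<rho>) f \<longleftrightarrow> integrable lborel (\<lambda>x. \<rho> x * f x)"
  unfolding weighted_measure_def
  using assms by (subst integrable_density) (auto simp: smooth_measurable less_imp_le)

text \<open>The squared first derivatives get 3/4 from the Laplacian and -1/2 from the drift,
  leaving 1/4. The resulting form, free of \<open>powr\<close>, makes the continuity of the
  potential visible.\<close>

lemma generator_inverse_sqrt:
  fixes \<rho> :: "real^'n::finite \<Rightarrow> real"
  assumes "smooth \<rho>" and pos: "\<And>x. \<rho> x > 0"
  shows "generator \<rho> (\<lambda>x. \<rho> x powr (- 1 / 2)) x / \<rho> x powr (- 1 / 2) =
    (\<Sum>i\<in>UNIV. (partial i \<rho> x)\<^sup>2 / (4 * (\<rho> x)\<^sup>2) - partial i (partial i \<rho>) x / (2 * \<rho> x))"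
proof -
  note d = smooth_differentiable[OF assms(1)]
  have p1: "partial i (\<lambda>x. \<rho> x powr a) = (\<lambda>x. a * (\<rho> x powr (a - 1) * partial i \<rho> x))" for i a
    using pos by (auto simp: partial_powr[OF d])
  let ?v = "\<rho> x powr (- 1 / 2)"
  have e: "- 1 / 2 - 1 = (- 3 / 2 :: real)" "- 3 / 2 - 1 = (- 5 / 2 :: real)" by simp_all
  \<comment> \<open>All fractional powers become \<open>?v\<close> times an integer power of
    \<open>\<rho> x\<close>, so \<open>?v\<close> can be factored out and cancelled at the
    end.\<close>
  have r: "\<rho> x powr (- 3 / 2) = ?v / \<rho> x" "\<rho> x powr (- 5 / 2) = ?v / (\<rho> x)\<^sup>2"
    using powr_diff[of "\<rho> x" "- 1 / 2" 1] powr_diff[of "\<rho> x" "- 1 / 2" 2] pos[of x] by simp_all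
  have p2: "partial i (partial i (\<lambda>x. \<rho> x powr (- 1 / 2))) x =
      3 / 4 * (?v / (\<rho> x)\<^sup>2) * (partial i \<rho> x)\<^sup>2
        - 1 / 2 * (?v / \<rho> x) * partial i (partial i \<rho>) x" for i
  proof -
    have dp: "partial i \<rho> differentiable (at x)" "(\<lambda>x. \<rho> x powr a) differentiable (at x)" for a
      using assms by (auto intro: smooth_differentiable smooth_partial smooth_powr)
    have dm: "(\<lambda>x. \<rho> x powr (- 3 / 2) * partial i \<rho> x) differentiable (at x)"
      by (intro differentiable_mult dp)
    have p3: "partial i (\<lambda>x. \<rho> x powr (- 3 / 2) * partial i \<rho> x) x =
        \<rho> x powr (- 3 / 2) * partial i (partial i \<rho>) x
        + - 3 / 2 * (\<rho> x powr (- 5 / 2) * partial i \<rho> x) * partial i \<rho> x"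
      by (simp only: partial_mult[OF dp(2) dp(1)] p1 e)
    have p4: "partial i (\<lambda>x. - 1 / 2 * (\<rho> x powr (- 3 / 2) * partial i \<rho> x)) x =
        - 1 / 2 * partial i (\<lambda>x. \<rho> x powr (- 3 / 2) * partial i \<rho> x) x"
      by (simp only: partial_mult[OF differentiable_const dm] partial_const mult_zero_left add_0_right)
    show ?thesis
      unfolding p1 e p4 p3 r by (simp add: power2_eq_square field_simps)
  qed
  have "generator \<rho> (\<lambda>x. \<rho> x powr (- 1 / 2)) x =
      (\<Sum>i\<in>UNIV. ?v * ((partial i \<rho> x)\<^sup>2 / (4 * (\<rho> x)\<^sup>2) - partial i (partial i \<rho>) x / (2 * \<rho> x)))"
    unfolding generator_def laplacian_def grad_def inner_vec_def sum.distrib[symmetric]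
  proof (rule sum.cong[OF refl])
    fix i
    show "partial i (partial i (\<lambda>x. \<rho> x powr (- 1 / 2))) x
        + (\<chi> i. partial i (\<lambda>y. ln (\<rho> y)) x) $ i \<bullet> (\<chi> i. partial i (\<lambda>x. \<rho> x powr (- 1 / 2)) x) $ i
      = ?v * ((partial i \<rho> x)\<^sup>2 / (4 * (\<rho> x)\<^sup>2) - partial i (partial i \<rho>) x / (2 * \<rho> x))"
      unfolding p2 vec_lambda_beta inner_real_def partial_ln[OF d pos] partial_powr[OF d pos] e r
      using pos[of x] by (simp add: field_simps power2_eq_square)
  qed
  moreover have "?v \<noteq> 0" using pos[of x] by simp
  ultimately show ?thesis
    by (simp only: sum_distrib_left[symmetric] nonzero_mult_div_cancel_left not_False_eq_True)
qed

text \<open>One coordinate of the energy identity. Squaring the product rule produces the cross term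
  \<open>f x * partial i f x * partial i \<rho> x\<close>; the last summand contains it, and its
  second-derivative part cancels against the potential.\<close>

lemma partial_mult_sqrt_power2:
  fixes \<rho> :: "real^'n::finite \<Rightarrow> real"
  assumes "smooth \<rho>" and pos: "\<And>x. \<rho> x > 0" and "smooth f"
  shows "(partial i (\<lambda>x. f x * \<rho> x powr (1 / 2)) x)\<^sup>2 =
    \<rho> x * (partial i f x)\<^sup>2
    + \<rho> x * (((partial i \<rho> x)\<^sup>2 / (4 * (\<rho> x)\<^sup>2) - partial i (partial i \<rho>) x / (2 * \<rho> x)) * (f x)\<^sup>2)
    + partial i (\<lambda>x. f x * f x * (partial i \<rho> x * (1 / 2))) x"
proof -
  note d = smooth_differentiable
  define s where "s = \<rho> x powr (1 / 2)"
  have s: "s > 0" "\<rho> x = s * s"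
    using pos[of x] by (auto simp: s_def powr_add[symmetric] less_imp_neq[symmetric])
  have "\<rho> x powr (1 / 2 - 1) = s / \<rho> x"
    using powr_diff[of "\<rho> x" "1 / 2" 1] pos[of x] by (simp add: s_def)
  then have 1: "partial i (\<lambda>x. f x * \<rho> x powr (1 / 2)) x =
      f x * (1 / 2 * (s / \<rho> x) * partial i \<rho> x) + partial i f x * s"
    by (simp only: partial_mult[OF d[OF assms(3)] d[OF smooth_powr[OF assms(1) pos]]]
        partial_powr[OF d[OF assms(1)] pos] s_def)
  have 2: "partial i (\<lambda>x. f x * f x * (partial i \<rho> x * (1 / 2))) x =
      f x * f x * (partial i (partial i \<rho>) x * (1 / 2))
      + (f x * partial i f x + partial i f x * f x) * (partial i \<rho> x * (1 / 2))"
    using assms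
    by (simp add: partial_mult partial_const d smooth_mult smooth_partial smooth_const
        del: times_divide_eq_right)
  have 3: "s / \<rho> x = 1 / s" "\<rho> x * (a / (4 * (\<rho> x)\<^sup>2) - b / (2 * \<rho> x)) = a * (1 / s)\<^sup>2 / 4 - b / 2"
    for a b :: real
    using s(1) unfolding s(2) by (simp_all add: field_simps power2_eq_square)
  \<comment> \<open>After the rewriting the claim is polynomial in \<open>s\<close> and
    \<open>1 / s\<close>, and follows modulo this single relation.\<close>
  have "s * (1 / s) = 1" using s(1) by simp
  then show ?thesis
    unfolding 1 2 mult.assoc[of "\<rho> x" _ "(f x)\<^sup>2", symmetric] 3 unfolding s(2) by algebra
qed

text \<open>The coordinate identities are summed and integrated. Integrability of the potential term
  is recorded as well, because bounding this term by monotonicity of the integral depends on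
  it.\<close>

lemma dirichlet_energy_ground_state:
  fixes \<rho> :: "real^'n::finite \<Rightarrow> real"
  assumes sm: "smooth \<rho>" and pos: "\<And>x. \<rho> x > 0" and f: "test_function f"
  defines "V \<equiv> \<lambda>x. \<rho> x powr (- 1 / 2)"
  shows "integrable (weighted_measure \<rho>) (\<lambda>x. generator \<rho> V x / V x * (f x)\<^sup>2)"
    and "(LINT x|lborel. (norm (grad (\<lambda>x. f x * \<rho> x powr (1 / 2)) x))\<^sup>2) =
      dirichlet_energy \<rho> f + (LINT x|weighted_measure \<rho>. generator \<rho> V x / V x * (f x)\<^sup>2)"
proof -
  let ?K = "closure {x. f x \<noteq> 0}"
  define W where "W = (\<lambda>x. generator \<rho> V x / V x)"
  \<comment> \<open>The components of the vector field whose divergence is the error term; the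
    factor \<open>f\<close> gives them compact support.\<close>
  define h where "h i x = f x * f x * (partial i \<rho> x * (1 / 2))" for i x
  have W: "W x = (\<Sum>i\<in>UNIV. (partial i \<rho> x)\<^sup>2 / (4 * (\<rho> x)\<^sup>2) - partial i (partial i \<rho>) x / (2 * \<rho> x))"
    for x unfolding W_def V_def by (rule generator_inverse_sqrt[OF sm pos])
  have smf: "smooth f" and K: "compact ?K" using f by (auto simp: test_function_def)
  note sc = smooth_continuous_on smooth_partial
  have contW: "continuous_on UNIV W"
    unfolding W[abs_def] using pos
    by (intro continuous_intros sc sm) (auto simp: less_imp_neq[symmetric])
  have cW: "continuous_on UNIV (\<lambda>x. W x * (f x)\<^sup>2)"
    by (intro continuous_intros contW sc smf)
  have c1: "continuous_on UNIV (\<lambda>x. \<rho> x * (norm (grad f x))\<^sup>2)"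
    by (intro continuous_on_mult continuous_norm_grad_power2 sc sm smf)
  have c2: "continuous_on UNIV (\<lambda>x. \<rho> x * (W x * (f x)\<^sup>2))"
    by (intro continuous_on_mult cW sc sm)
  have i1: "integrable lborel (\<lambda>x. \<rho> x * (norm (grad f x))\<^sup>2)"
    by (rule integrable_compact_support[OF c1 K]) (auto simp: grad_zero_outside_closure)
  have i2: "integrable lborel (\<lambda>x. \<rho> x * (W x * (f x)\<^sup>2))"
    by (rule integrable_compact_support[OF c2 K]) (auto dest: zero_outside_closure)
  have h: "test_function (h i)" for i
    unfolding h_def[abs_def]
    by (intro test_function_mult f smf smooth_mult smooth_partial sm smooth_const)
  then have h': "smooth (h i)" "compact (closure {x. h i x \<noteq> 0})" for i
    by (auto simp: test_function_def)
  have ih: "integrable lborel (partial i (h i))" for i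
    by (rule integrable_compact_support[OF _ h'(2)])
      (auto intro: sc h' partial_zero_outside_closure)
  have h0: "(LINT x|lborel. partial i (h i) x) = 0" for i
    by (rule integral_partial_eq_0[OF _ h'(2)]) (use h'(1) smooth_def in blast)
  have eq: "(norm (grad (\<lambda>x. f x * \<rho> x powr (1 / 2)) x))\<^sup>2 =
      \<rho> x * (norm (grad f x))\<^sup>2 + \<rho> x * (W x * (f x)\<^sup>2) + (\<Sum>i\<in>UNIV. partial i (h i) x)" for x
    unfolding norm_grad_power2 W partial_mult_sqrt_power2[OF sm pos smf] h_def[abs_def]
    by (simp add: sum.distrib sum_distrib_left sum_distrib_right)
  have mW: "(\<lambda>x. W x * (f x)\<^sup>2) \<in> borel_measurable borel"
    by (rule borel_measurable_continuous_onI[OF cW])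
  have mg: "(\<lambda>x. (norm (grad f x))\<^sup>2) \<in> borel_measurable borel"
    by (rule borel_measurable_continuous_onI[OF continuous_norm_grad_power2[OF smf]])
  show "integrable (weighted_measure \<rho>) (\<lambda>x. generator \<rho> V x / V x * (f x)\<^sup>2)"
    using i2 integrable_weighted_measure[OF sm pos mW] by (simp add: W_def)
  have "(LINT x|lborel. (norm (grad (\<lambda>x. f x * \<rho> x powr (1 / 2)) x))\<^sup>2) =
      (LINT x|lborel. \<rho> x * (norm (grad f x))\<^sup>2) + (LINT x|lborel. \<rho> x * (W x * (f x)\<^sup>2))"
    \<comment> \<open>Linearity of the Bochner integral applies because each summand is integrable;
      the divergence terms drop out by \<open>h0\<close>.\<close>
    unfolding eq using i1 i2 ih h0 by (simp add: Bochner_Integration.integral_sum)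
  then show "(LINT x|lborel. (norm (grad (\<lambda>x. f x * \<rho> x powr (1 / 2)) x))\<^sup>2) =
      dirichlet_energy \<rho> f + (LINT x|weighted_measure \<rho>. generator \<rho> V x / V x * (f x)\<^sup>2)"
    using integral_weighted_measure[OF sm pos mW] integral_weighted_measure[OF sm pos mg]
    by (simp add: W_def dirichlet_energy_def)
qed

section \<open>Norms as integrals, and matching of exponents\<close>

lemma lp_norm_2_powr:
  "lp_norm M 2 f powr (2 + 4 / n) = (LINT x|M. (f x)\<^sup>2) powr (1 + 2 / n)"
proof -
  have "1 / 2 * (2 + 4 / n) = 1 + 2 / n" by (simp add: distrib_left)
  moreover have "\<bar>y\<bar> powr 2 = y\<^sup>2" for y :: real
    by (cases "y = 0") (simp_all add: powr_numeral)
  ultimately show ?thesis by (simp only: lp_norm_def powr_powr)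
qed

lemma lp_norm_1: "lp_norm M 1 f = (LINT x|M. \<bar>f x\<bar>)"
  by (simp add: lp_norm_def)

text \<open>The map raising to the power \<open>4 / n\<close> is strictly increasing on nonnegative
  reals, so applying it to both sides loses nothing. It turns the power of \<open>D\<close> into
  \<open>D\<close> itself.\<close>

lemma nash_powr_iff:
  fixes A D B C n :: real
  assumes "A \<ge> 0" "B \<ge> 0" "D \<ge> 0" "C > 0" "n > 0"
  shows "A powr (1 / 2 * (1 + n / 2)) \<le> C * B * D powr (n / 4) \<longleftrightarrow>
    A powr (1 + 2 / n) \<le> C powr (4 / n) * B powr (4 / n) * D"
proof -
  have mono: "x \<le> y \<longleftrightarrow> x powr (4 / n) \<le> y powr (4 / n)" if "x \<ge> 0" "y \<ge> 0" for x y :: real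
    using that \<open>n > 0\<close> powr_mono2[of "4 / n" x y] powr_less_mono2[of "4 / n" y x]
    by (auto simp: not_le[symmetric])
  have "1 / 2 * (1 + n / 2) * (4 / n) = 1 + 2 / n" and 1: "n / 4 * (4 / n) = 1"
    using assms by (simp_all add: field_simps)
  then have "(A powr (1 / 2 * (1 + n / 2))) powr (4 / n) = A powr (1 + 2 / n)"
    by (simp only: powr_powr)
  moreover have "(C * B * D powr (n / 4)) powr (4 / n) = C powr (4 / n) * B powr (4 / n) * D"
    using assms by (simp add: powr_mult powr_powr 1
        del: times_divide_times_eq times_divide_eq_right times_divide_eq_left)
  ultimately show ?thesis
    using assms by (subst mono) auto
qed

text \<open>Every integrand here is continuous with compact support, so the value 0 which the
  Bochner integral assigns to non-integrable functions never enters.\<close>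

theorem theorem3p1:
  fixes \<rho> :: "real^'n::finite \<Rightarrow> real" and C :: real
  defines "n \<equiv> real CARD('n)"
    and "\<mu> \<equiv> weighted_measure \<rho>"
    and "V \<equiv> (\<lambda>x. \<rho> x powr (- 1 / 2))"
  assumes "smooth \<rho>" and "\<And>x. \<rho> x > 0" and "C > 0"
  shows
    "((\<forall>f :: real^'n \<Rightarrow> real. test_function f \<longrightarrow>
          (LINT x|lborel. (f x)\<^sup>2) powr (1 / 2 * (1 + n / 2))
          \<le> C * (LINT x|lborel. \<bar>f x\<bar>) * (LINT x|lborel. (norm (grad f x))\<^sup>2) powr (n / 4))
      \<longleftrightarrow>
      (\<forall>f :: real^'n \<Rightarrow> real. test_function f \<longrightarrow>
          lp_norm \<mu> 2 f powr (2 + 4 / n)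
          \<le> C powr (4 / n) * lp_norm \<mu> 1 (\<lambda>x. f x * V x) powr (4 / n)
             * (dirichlet_energy \<rho> f + (LINT x|\<mu>. generator \<rho> V x / V x * (f x)\<^sup>2))))
     \<and>
     (\<forall>c :: real. (\<forall>x. generator \<rho> V x \<le> c * V x) \<longrightarrow>
        (\<forall>f :: real^'n \<Rightarrow> real. test_function f \<longrightarrow>
          (LINT x|lborel. (f x)\<^sup>2) powr (1 / 2 * (1 + n / 2))
          \<le> C * (LINT x|lborel. \<bar>f x\<bar>) * (LINT x|lborel. (norm (grad f x))\<^sup>2) powr (n / 4)) \<longrightarrow>
        (\<forall>f :: real^'n \<Rightarrow> real. test_function f \<longrightarrow>
          lp_norm \<mu> 2 f powr (2 + 4 / n)
          \<le> C powr (4 / n) * lp_norm \<mu> 1 (\<lambda>x. f x * V x) powr (4 / n)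
             * (dirichlet_energy \<rho> f + c * (LINT x|\<mu>. (f x)\<^sup>2))))"
proof -
  define \<sigma> where "\<sigma> x = \<rho> x powr (1 / 2)" for x
  note sm = \<open>smooth \<rho>\<close> and pos = \<open>\<And>x. \<rho> x > 0\<close>
  have n: "n > 0" by (simp add: n_def)
  \<comment> \<open>\<open>\<sigma>\<close> and \<open>V\<close> are mutually inverse smooth
    factors, so multiplication by them gives inverse bijections of the test functions.\<close>
  have \<sigma>V: "\<sigma> x * V x = 1" "\<sigma> x * \<sigma> x = \<rho> x" "\<rho> x * V x = \<sigma> x" "\<sigma> x > 0" for x
    using pos[of x] powr_add[of "\<rho> x" "1 / 2" "- 1 / 2"] powr_add[of "\<rho> x" "1 / 2" "1 / 2"]
      powr_add[of "\<rho> x" 1 "- 1 / 2"] by (auto simp: \<sigma>_def V_def)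
  have V0: "V x > 0" for x using pos[of x] by (simp add: V_def)
  have sm\<sigma>: "smooth \<sigma>" and smV: "smooth V"
    unfolding \<sigma>_def[abs_def] V_def using sm pos by (auto intro: smooth_powr)
  let ?nash = "\<lambda>f :: real^'n \<Rightarrow> real. (LINT x|lborel. (f x)\<^sup>2) powr (1 / 2 * (1 + n / 2))
      \<le> C * (LINT x|lborel. \<bar>f x\<bar>) * (LINT x|lborel. (norm (grad f x))\<^sup>2) powr (n / 4)"
  let ?wnash = "\<lambda>f :: real^'n \<Rightarrow> real. lp_norm \<mu> 2 f powr (2 + 4 / n)
      \<le> C powr (4 / n) * lp_norm \<mu> 1 (\<lambda>x. f x * V x) powr (4 / n)
         * (dirichlet_energy \<rho> f + (LINT x|\<mu>. generator \<rho> V x / V x * (f x)\<^sup>2))"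
  have key: "?nash (\<lambda>x. f x * \<sigma> x) \<longleftrightarrow> ?wnash f" if f: "test_function f" for f
  proof -
    have [measurable]: "f \<in> borel_measurable borel" "V \<in> borel_measurable borel"
      using f smV by (auto simp: test_function_def smooth_measurable)
    have "(LINT x|\<mu>. (f x)\<^sup>2) = (LINT x|lborel. \<rho> x * (f x)\<^sup>2)"
      unfolding \<mu>_def by (rule integral_weighted_measure[OF sm pos]) measurable
    then have a: "(LINT x|\<mu>. (f x)\<^sup>2) = (LINT x|lborel. (f x * \<sigma> x)\<^sup>2)"
      by (simp add: power2_eq_square \<sigma>V(2)[symmetric] ac_simps)
    have "(LINT x|\<mu>. \<bar>f x * V x\<bar>) = (LINT x|lborel. \<rho> x * \<bar>f x * V x\<bar>)"
      unfolding \<mu>_def by (rule integral_weighted_measure[OF sm pos]) measurable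
    also have "\<dots> = (LINT x|lborel. \<bar>f x * \<sigma> x\<bar>)"
      using V0 pos by (simp add: abs_mult \<sigma>V(3)[symmetric] less_imp_le ac_simps)
    finally have b: "(LINT x|\<mu>. \<bar>f x * V x\<bar>) = (LINT x|lborel. \<bar>f x * \<sigma> x\<bar>)" .
    \<comment> \<open>The potential may be negative, but this identifies the bracket with the
      integral of a square; its nonnegativity is what \<open>nash_powr_iff\<close> asks for.\<close>
    have e: "dirichlet_energy \<rho> f + (LINT x|\<mu>. generator \<rho> V x / V x * (f x)\<^sup>2) =
        (LINT x|lborel. (norm (grad (\<lambda>x. f x * \<sigma> x) x))\<^sup>2)"
      unfolding \<sigma>_def V_def \<mu>_def
      by (rule dirichlet_energy_ground_state(2)[OF sm pos f, symmetric])
    show ?thesis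
      unfolding lp_norm_2_powr lp_norm_1 a b e
      by (rule nash_powr_iff) (use n \<open>C > 0\<close> in auto)
  qed
  have equiv: "(\<forall>f. test_function f \<longrightarrow> ?nash f) \<longleftrightarrow> (\<forall>f. test_function f \<longrightarrow> ?wnash f)"
  proof (intro iffI allI impI)
    fix f :: "real^'n \<Rightarrow> real" assume "\<forall>f. test_function f \<longrightarrow> ?nash f" and f: "test_function f"
    then show "?wnash f" using key[OF f] test_function_mult[OF f sm\<sigma>] by blast
  next
    fix g :: "real^'n \<Rightarrow> real" assume all: "\<forall>f. test_function f \<longrightarrow> ?wnash f" and g: "test_function g"
    \<comment> \<open>The preimage of \<open>g\<close> under the substitution, since
      \<open>V\<close> cancels \<open>\<sigma>\<close>.\<close>
    have f: "test_function (\<lambda>x. g x * V x)" by (rule test_function_mult[OF g smV])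
    have eq: "g x * V x * \<sigma> x = g x" for x
      using \<sigma>V(1) by (simp add: mult.assoc mult.commute[of "V _"])
    from all f have "?wnash (\<lambda>x. g x * V x)" by blast
    then show "?nash g" unfolding key[OF f, symmetric] eq .
  qed
  have "lp_norm \<mu> 2 f powr (2 + 4 / n) \<le> C powr (4 / n) * lp_norm \<mu> 1 (\<lambda>x. f x * V x) powr (4 / n)
      * (dirichlet_energy \<rho> f + c * (LINT x|\<mu>. (f x)\<^sup>2))"
    if c: "\<forall>x. generator \<rho> V x \<le> c * V x" and w: "?wnash f" and f: "test_function f"
    for c and f :: "real^'n \<Rightarrow> real"
  proof -
    have smf: "smooth f" and K: "compact (closure {x. f x \<noteq> 0})"
      using f by (auto simp: test_function_def)
    have "continuous_on UNIV (\<lambda>x. \<rho> x * (f x)\<^sup>2)"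
      by (intro continuous_on_mult continuous_on_power smooth_continuous_on sm smf)
    then have "integrable lborel (\<lambda>x. \<rho> x * (f x)\<^sup>2)"
      by (rule integrable_compact_support[OF _ K]) (auto dest: zero_outside_closure)
    then have i: "integrable \<mu> (\<lambda>x. (f x)\<^sup>2)"
      unfolding \<mu>_def using smooth_measurable[OF smf]
      by (subst integrable_weighted_measure[OF sm pos]) auto
    have "(LINT x|\<mu>. generator \<rho> V x / V x * (f x)\<^sup>2) \<le> (LINT x|\<mu>. c * (f x)\<^sup>2)"
    proof (rule integral_mono)
      show "integrable \<mu> (\<lambda>x. generator \<rho> V x / V x * (f x)\<^sup>2)"
        unfolding \<mu>_def V_def by (rule dirichlet_energy_ground_state(1)[OF sm pos f])
      \<comment> \<open>Dividing by \<open>V x > 0\<close> preserves the hypothesis on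
        \<open>c\<close>, whatever the sign of \<open>c\<close>.\<close>
      show "generator \<rho> V x / V x * (f x)\<^sup>2 \<le> c * (f x)\<^sup>2" for x
        using c V0[of x] by (intro mult_right_mono) (auto simp: divide_le_eq)
    qed (use i in simp)
    then have "dirichlet_energy \<rho> f + (LINT x|\<mu>. generator \<rho> V x / V x * (f x)\<^sup>2)
        \<le> dirichlet_energy \<rho> f + c * (LINT x|\<mu>. (f x)\<^sup>2)"
      by simp
    then show ?thesis
      \<comment> \<open>The factor in front of the bracket is nonnegative, so enlarging the bracket
        weakens the inequality.\<close>
      using w by (elim order_trans) (intro mult_left_mono, auto)
  qed
  with equiv show ?thesis by blast
qed

end
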